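(* Let $\mathbf X\in\mathbb R^{n\times n}$ be a matrix with no entry equal to $0$ that admits a decomposition $\mathbf X=\boldsymbol\Lambda\mathbf Q\mathbf M$, where $\boldsymbol\Lambda,\mathbf M\in\mathbb R^{n\times n}$ are diagonal and $\mathbf Q\in\mathbb R^{n\times n}$ is orthogonal. Then the Sinkhorn-based algorithm described in the context, applied to $\mathbf X$, converges and finds $\boldsymbol\Lambda,\mathbf Q,\mathbf M$ up to permutation and sign (and up to the rescaling $(\boldsymbol\Lambda,\mathbf M)\mapsto(c\boldsymbol\Lambda,c^{-1}\mathbf M)$): its output $(\boldsymbol\Lambda',\mathbf Q',\mathbf M')$ consists of diagonal matrices $\boldsymbol\Lambda',\mathbf M'$ and an orthogonal matrix $\mathbf Q'$ with $\mathbf X=\boldsymbol\Lambda'\mathbf Q'\mathbf M'$, and there are permutation matrices $P_1,P_2$, diagonal matrices $D_1,D_2$ with diagonal entries in $\{1,-1\}$, and $c>0$ such that $\boldsymbol\Lambda'=c\,P_1\boldsymbol\Lambda D_1P_1^\top$, $\mathbf Q'=P_1D_1\mathbf QD_2P_2^\top$ and $\mathbf M'=c^{-1}P_2D_2\mathbf MP_2^\top$.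
   Context: Notation: $\mathbf Y^{*2}$ and $\sqrt[*]{\mathbf Y}$ denote the entrywise square and entrywise (nonnegative) square root of a matrix, and $\odot$ the entrywise (Hadamard) product. Sinkhorn-based algorithm, input $\mathbf X$: 1. Apply Sinkhorn's algorithm to the positive matrix $\mathbf X^{*2}$: alternately rescale all rows so that each row sums to 1, then all columns so that each column sums to 1, and so on, passing to the limit. This yields diagonal matrices $\widetilde{\boldsymbol\Lambda},\widetilde{\mathbf M}$ with positive diagonal entries (the total row and column rescalings) and a doubly stochastic matrix $\widetilde{\mathbf Q}$ with $\widetilde{\boldsymbol\Lambda}\,\mathbf X^{*2}\,\widetilde{\mathbf M}=\widetilde{\mathbf Q}$. 2. Let $\mathbf S$ be the sign matrix of $\mathbf X$: $\mathbf S_{ij}=1$ if $\mathbf X_{ij}>0$ and $\mathbf S_{ij}=-1$ if $\mathbf X_{ij}<0$. 3. Output $\boldsymbol\Lambda'=\big(\sqrt[*]{\widetilde{\boldsymbol\Lambda}}\big)^{-1}$, $\mathbf Q'=\mathbf S\odot\sqrt[*]{\widetilde{\mathbf Q}}$, $\mathbf M'=\big(\sqrt[*]{\widetilde{\mathbf M}}\big)^{-1}$. *)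

theory Defs
  imports "HOL-Analysis.Analysis"
begin

definition hadamard :: "real^'n^'m \<Rightarrow> real^'n^'m \<Rightarrow> real^'n^'m"  (infixl "\<odot>" 70) where
  "A \<odot> B = (\<chi> i j. A $ i $ j * B $ i $ j)"

definition entrywise_square :: "real^'n^'m \<Rightarrow> real^'n^'m" where
  "entrywise_square A = (\<chi> i j. (A $ i $ j)\<^sup>2)"

(* Used below on entrywise nonnegative matrices only; HOL's sqrt is odd on the negative reals. *)
definition entrywise_sqrt :: "real^'n^'m \<Rightarrow> real^'n^'m" where
  "entrywise_sqrt A = (\<chi> i j. sqrt (A $ i $ j))"

definition sign_matrix :: "real^'n^'m \<Rightarrow> real^'n^'m" where
  "sign_matrix A = (\<chi> i j. sgn (A $ i $ j))"

definition diagonal_matrix :: "real^'n^'n \<Rightarrow> bool" where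
  "diagonal_matrix A \<longleftrightarrow> (\<forall>i j. i \<noteq> j \<longrightarrow> A $ i $ j = 0)"

definition positive_diagonal :: "real^'n^'n \<Rightarrow> bool" where
  "positive_diagonal A \<longleftrightarrow> diagonal_matrix A \<and> (\<forall>i. A $ i $ i > 0)"

definition sign_diagonal :: "real^'n^'n \<Rightarrow> bool" where
  "sign_diagonal A \<longleftrightarrow> diagonal_matrix A \<and> (\<forall>i. A $ i $ i \<in> {1, -1})"

definition permutation_matrix :: "real^'n^'n \<Rightarrow> bool" where
  "permutation_matrix P \<longleftrightarrow> (\<exists>p. bij p \<and> P = (\<chi> i j. if j = p i then 1 else 0))"

definition doubly_stochastic :: "real^'n^'n \<Rightarrow> bool" where
  "doubly_stochastic A \<longleftrightarrow> (\<forall>i j. A $ i $ j \<ge> 0) \<and>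
     (\<forall>i. (\<Sum>j\<in>UNIV. A $ i $ j) = 1) \<and> (\<forall>j. (\<Sum>i\<in>UNIV. A $ i $ j) = 1)"

definition row_rescaling :: "real^'n^'n \<Rightarrow> real^'n^'n" where
  "row_rescaling A = (\<chi> i j. if i = j then 1 / (\<Sum>l\<in>UNIV. A $ i $ l) else 0)"

definition col_rescaling :: "real^'n^'n \<Rightarrow> real^'n^'n" where
  "col_rescaling A = (\<chi> i j. if i = j then 1 / (\<Sum>l\<in>UNIV. A $ l $ j) else 0)"

(* The state (L, B, M) after k rescalings of A consists of the accumulated row rescaling L, the
   current matrix B, and the accumulated column rescaling M.  Every single rescaling counts as one
   step, so convergence of the states also covers the matrices right after a row rescaling. *)
primrec sinkhorn :: "real^'n^'n \<Rightarrow> nat \<Rightarrow> (real^'n^'n) \<times> (real^'n^'n) \<times> (real^'n^'n)" where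
  "sinkhorn A 0 = (mat 1, A, mat 1)"
| "sinkhorn A (Suc k) = (case sinkhorn A k of (L, B, M) \<Rightarrow>
     if even k then (row_rescaling B ** L, row_rescaling B ** B, M)
     else (L, B ** col_rescaling B, M ** col_rescaling B))"

(* Meaningful only if the iteration converges, since lim is unspecified on divergent sequences. *)
definition sinkhorn_algorithm ::
    "real^'n^'n \<Rightarrow> (real^'n^'n) \<times> (real^'n^'n) \<times> (real^'n^'n)" where
  "sinkhorn_algorithm X = (case lim (sinkhorn (entrywise_square X)) of (L, Q, M) \<Rightarrow>
     (matrix_inv (entrywise_sqrt L), sign_matrix X \<odot> entrywise_sqrt Q,
      matrix_inv (entrywise_sqrt M)))"

end

theory Submission
  imports Defs "HOL-Probability.Characteristic_Functions"
begin

text \<open>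
  Writing X = diag f Q diag g, the matrix of squares is diag f^2 S diag g^2 with S the entrywise
  square of Q, which is positive and doubly stochastic. Relative to S the algorithm only updates
  scaling vectors: u = 1/(S v), then v = 1/(S^T u). Both steps average, so the interval spanned by
  the entries of v shrinks by a fixed factor in each cycle and v tends to a positive constant.
  Hence the current matrix tends to S and the accumulated rescalings to multiples of f^(-2) and
  g^(-2); taking roots recovers the factors up to signs, with trivial permutations.
\<close>

section \<open>Diagonal matrices, inverses and orthogonality\<close>

definition diag_matrix :: "('n \<Rightarrow> real) \<Rightarrow> real^'n^'n" where
  "diag_matrix f = (\<chi> i j. if i = j then f i else 0)"

lemma diag_matrix_nth: "diag_matrix f $ i $ j = (if i = j then f i else 0)"
  by (simp add: diag_matrix_def)

lemma diagonal_diag_matrix [simp]: "diagonal_matrix (diag_matrix f)"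
  by (simp add: diagonal_matrix_def diag_matrix_nth)

lemma diagonal_matrix_eq_diag_matrix: "diagonal_matrix A \<Longrightarrow> A = diag_matrix (\<lambda>i. A $ i $ i)"
  by (auto simp: diagonal_matrix_def diag_matrix_def vec_eq_iff)

lemma diag_matrix_mult_nth: "(diag_matrix f ** B) $ i $ j = f i * B $ i $ j"
  by (simp add: matrix_matrix_mult_def diag_matrix_nth if_distrib[of "\<lambda>x. x * _"] cong: if_cong)

lemma mult_diag_matrix_nth: "(B ** diag_matrix f) $ i $ j = B $ i $ j * f j"
  by (simp add: matrix_matrix_mult_def diag_matrix_nth if_distrib[of "\<lambda>x. _ * x"] cong: if_cong)

lemma diag_matrix_mult: "diag_matrix f ** diag_matrix g = diag_matrix (\<lambda>i. f i * g i)"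
  by (simp add: vec_eq_iff diag_matrix_mult_nth diag_matrix_nth)

lemma diag_matrix_one: "diag_matrix (\<lambda>i. 1) = mat 1"
  by (simp add: diag_matrix_def mat_def)

text \<open>\<open>matrix_inv\<close> is a Hilbert choice: \<open>B\<close> witnesses that the
  chosen matrix is a two-sided inverse, and two-sided inverses coincide.\<close>

lemma matrix_inv_unique:
  fixes A B :: "real^'n^'n"
  assumes "A ** B = mat 1" "B ** A = mat 1"
  shows "matrix_inv A = B"
proof -
  have "A ** matrix_inv A = mat 1 \<and> matrix_inv A ** A = mat 1"
    unfolding matrix_inv_def by (rule someI[of _ B]) (simp add: assms)
  then show ?thesis
    by (metis assms(2) matrix_mul_assoc matrix_mul_lid matrix_mul_rid)
qed

lemma matrix_inv_diag_matrix:
  assumes "\<And>i. f i \<noteq> 0"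
  shows "matrix_inv (diag_matrix f) = diag_matrix (\<lambda>i. inverse (f i))"
  by (rule matrix_inv_unique) (simp_all add: diag_matrix_mult diag_matrix_one assms)

lemma orthogonal_diag_matrix:
  assumes "\<And>i. f i * f i = 1"
  shows "orthogonal_matrix (diag_matrix f)"
proof -
  have "transpose (diag_matrix f) = diag_matrix f"
    by (auto simp: vec_eq_iff transpose_def diag_matrix_nth)
  then show ?thesis
    by (simp add: orthogonal_matrix_def diag_matrix_mult diag_matrix_one assms)
qed

text \<open>The row sums of the squares are the diagonal entries of \<open>Q ** transpose Q\<close>,
  the column sums those of \<open>transpose Q ** Q\<close>, and both products are the
  identity.\<close>

lemma doubly_stochastic_square_orthogonal:
  assumes "orthogonal_matrix Q"
  shows "doubly_stochastic (entrywise_square Q)"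
proof -
  have 1: "(Q ** transpose Q) $ i $ i = 1" "(transpose Q ** Q) $ i $ i = 1" for i
    using assms by (simp_all add: orthogonal_matrix_def mat_def)
  then show ?thesis
    by (simp add: doubly_stochastic_def entrywise_square_def matrix_matrix_mult_def transpose_def
        power2_eq_square)
qed

section \<open>Bounds for weighted averages\<close>

lemma convex_combination_contraction:
  fixes p v :: "'n::finite \<Rightarrow> real"
  assumes p: "\<And>j. t \<le> p j" "0 \<le> t" "(\<Sum>j\<in>UNIV. p j) = 1"
    and v: "\<And>j. v j \<le> b" "v k = a"
  shows "(\<Sum>j\<in>UNIV. p j * v j) \<le> b - t * (b - a)"
proof -
  have p0: "0 \<le> p j" for j using p(1)[of j] p(2) by simp
  have "t * (b - a) \<le> p k * (b - v k)"
    using p p0 v(1)[of k] v(2) by (intro mult_mono) auto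
  \<comment> \<open>All terms are nonnegative, so the single term at \<open>k\<close>, where the
    weight is at least \<open>t\<close> and the deficit is \<open>b - a\<close>, bounds the sum from
    below.\<close>
  also have "\<dots> \<le> (\<Sum>j\<in>UNIV. p j * (b - v j))"
    using p0 v by (intro member_le_sum) auto
  also have "\<dots> = b - (\<Sum>j\<in>UNIV. p j * v j)"
    using p(3) by (simp add: algebra_simps sum_subtractf flip: sum_distrib_left)
  finally show ?thesis by simp
qed

lemma convex_combination_bounds:
  fixes p v :: "'n::finite \<Rightarrow> real"
  assumes p: "\<And>j. 0 \<le> p j" "(\<Sum>j\<in>UNIV. p j) = 1"
  shows "(\<And>j. v j \<le> b) \<Longrightarrow> (\<Sum>j\<in>UNIV. p j * v j) \<le> b"
    and "(\<And>j. a \<le> v j) \<Longrightarrow> a \<le> (\<Sum>j\<in>UNIV. p j * v j)"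
proof -
  assume "\<And>j. v j \<le> b"
  then have "(\<Sum>j\<in>UNIV. p j * v j) \<le> (\<Sum>j\<in>UNIV. p j * b)"
    by (intro sum_mono mult_left_mono p)
  then show "(\<Sum>j\<in>UNIV. p j * v j) \<le> b" by (simp add: p flip: sum_distrib_right)
next
  assume "\<And>j. a \<le> v j"
  then have "(\<Sum>j\<in>UNIV. p j * a) \<le> (\<Sum>j\<in>UNIV. p j * v j)"
    by (intro sum_mono mult_left_mono p)
  then show "a \<le> (\<Sum>j\<in>UNIV. p j * v j)" by (simp add: p flip: sum_distrib_right)
qed

section \<open>The iteration on scaling vectors\<close>

definition sinkhorn_row :: "real^'n^'n \<Rightarrow> ('n \<Rightarrow> real) \<Rightarrow> 'n \<Rightarrow> real" where
  "sinkhorn_row S v i = 1 / (\<Sum>j\<in>UNIV. S $ i $ j * v j)"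

definition sinkhorn_col :: "real^'n^'n \<Rightarrow> ('n \<Rightarrow> real) \<Rightarrow> 'n \<Rightarrow> real" where
  "sinkhorn_col S u j = 1 / (\<Sum>i\<in>UNIV. S $ i $ j * u i)"

text \<open>Only the column scalings are stored, because each row scaling is computed from the
  column scaling before it. One index stands for a full cycle of two rescalings.\<close>

primrec sinkhorn_weights :: "real^'n^'n \<Rightarrow> ('n \<Rightarrow> real) \<Rightarrow> nat \<Rightarrow> 'n \<Rightarrow> real" where
  "sinkhorn_weights S b 0 = b"
| "sinkhorn_weights S b (Suc k) = sinkhorn_col S (sinkhorn_row S (sinkhorn_weights S b k))"

text \<open>The row half averages \<open>v\<close>, which lowers the upper bound because the value
  \<open>a\<close> is attained and every weight is at least \<open>t\<close>. The column half takes
  a weighted harmonic mean of these averages, which stays within their bounds.\<close>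

lemma sinkhorn_cycle_bounds:
  fixes S :: "real^'n^'n"
  assumes ds: "doubly_stochastic S"
    and S: "\<And>i j. t \<le> S $ i $ j" "0 \<le> t"
    and v: "\<And>j. a \<le> v j" "\<And>j. v j \<le> b" "v k = a" and a: "0 < a"
  shows "a \<le> sinkhorn_col S (sinkhorn_row S v) j"
    and "sinkhorn_col S (sinkhorn_row S v) j \<le> b - t * (b - a)"
proof -
  define w where "w i = (\<Sum>j\<in>UNIV. S $ i $ j * v j)" for i
  define b' where "b' = b - t * (b - a)"
  have S0: "0 \<le> S $ i $ j" for i j using ds by (simp add: doubly_stochastic_def)
  have rows: "(\<Sum>j\<in>UNIV. S $ i $ j) = 1" and cols: "(\<Sum>i\<in>UNIV. S $ i $ j) = 1" for i j
    using ds by (simp_all add: doubly_stochastic_def)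
  have wa: "a \<le> w i" for i
    unfolding w_def by (rule convex_combination_bounds(2)) (use S0 rows v in auto)
  have wb: "w i \<le> b'" for i
    unfolding w_def b'_def by (rule convex_combination_contraction) (use S rows v in auto)
  have b': "0 < b'" using a wa wb by (meson less_le_trans)
  have le: "1 / b' \<le> 1 / w i" "1 / w i \<le> 1 / a" for i
    using a wa[of i] wb[of i] by (auto intro!: divide_left_mono)
  \<comment> \<open>The column sums are 1, so \<open>s\<close> is a weighted mean of the reciprocals
    \<open>1 / w i\<close>.\<close>
  define s where "s = (\<Sum>i\<in>UNIV. S $ i $ j * (1 / w i))"
  have s: "1 / b' \<le> s" "s \<le> 1 / a"
    unfolding s_def using S0 cols le by (intro convex_combination_bounds; simp)+
  have "0 < s" using s(1) b' by (meson less_le_trans zero_less_divide_1_iff)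
  with s a b' have "a \<le> 1 / s" "1 / s \<le> b'" by (simp_all add: field_simps)
  moreover have "sinkhorn_col S (sinkhorn_row S v) j = 1 / s"
    by (simp add: sinkhorn_col_def sinkhorn_row_def w_def s_def)
  ultimately show "a \<le> sinkhorn_col S (sinkhorn_row S v) j"
    and "sinkhorn_col S (sinkhorn_row S v) j \<le> b - t * (b - a)"
    unfolding b'_def by simp_all
qed

text \<open>The minimum of the weights increases and the maximum decreases, while their gap shrinks
  at least by the factor \<open>1 - t\<close> per cycle, with \<open>t\<close> the smallest entry of
  \<open>S\<close>; both therefore have one common limit.\<close>

lemma sinkhorn_weights_tendsto_const:
  fixes S :: "real^'n^'n"
  assumes ds: "doubly_stochastic S" and S: "\<And>i j. 0 < S $ i $ j" and b: "\<And>j. 0 < b j"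
  obtains \<gamma> where "0 < \<gamma>" "\<And>j. (\<lambda>k. sinkhorn_weights S b k j) \<longlonglongrightarrow> \<gamma>"
proof -
  define t where "t = Min (range (\<lambda>(i, j). S $ i $ j))"
  have t0: "0 < t" unfolding t_def by (subst Min_gr_iff) (use S in auto)
  have t: "t \<le> S $ i $ j" for i j
    unfolding t_def by (rule Min_le) (auto intro: range_eqI[of _ _ "(i, j)"])
  \<comment> \<open>An entry is at most its row sum 1. This makes \<open>1 - t\<close> nonnegative,
    as the induction for the gap requires.\<close>
  have t1: "t \<le> 1"
  proof -
    fix i :: 'n
    have "S $ i $ i \<le> (\<Sum>j\<in>UNIV. S $ i $ j)"
      using S by (intro member_le_sum) (auto intro: less_imp_le)
    then show ?thesis using t[of i i] ds by (simp add: doubly_stochastic_def)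
  qed
  define v where "v = sinkhorn_weights S b"
  define l where "l k = Min (range (v k))" for k
  define h where "h k = Max (range (v k))" for k
  have lv: "l k \<le> v k j" and vh: "v k j \<le> h k" for k j
    by (simp_all add: l_def h_def)
  have att: "\<exists>j. v k j = l k" "\<exists>j. v k j = h k" for k
  proof -
    have "l k \<in> range (v k)" "h k \<in> range (v k)"
      unfolding l_def h_def by (rule Min_in Max_in; simp)+
    then show "\<exists>j. v k j = l k" "\<exists>j. v k j = h k" by (metis rangeE)+
  qed
  \<comment> \<open>Positivity of \<open>l k\<close> stays a premise here, since its own inductive
    proof uses the first of these bounds.\<close>
  have step: "l k \<le> v (Suc k) j" "v (Suc k) j \<le> h k - t * (h k - l k)" if "0 < l k" for k j
  proof -
    from att(1) obtain m where "v k m = l k" by blast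
    from sinkhorn_cycle_bounds[where v = "v k" and j = j, OF ds t less_imp_le[OF t0] lv vh this that]
    show "l k \<le> v (Suc k) j" "v (Suc k) j \<le> h k - t * (h k - l k)"
      by (simp_all add: v_def)
  qed
  have lpos: "0 < l k" for k
  proof (induction k)
    case 0
    from att(1)[of 0] b show ?case by (metis v_def sinkhorn_weights.simps(1))
  next
    case (Suc k)
    from att(1)[of "Suc k"] step(1)[OF Suc] Suc show ?case by (metis less_le_trans)
  qed
  have linc: "l k \<le> l (Suc k)" for k
    using att(1)[of "Suc k"] step(1)[OF lpos] by metis
  have hstep: "h (Suc k) \<le> h k - t * (h k - l k)" for k
    using att(2)[of "Suc k"] step(2)[OF lpos] by metis
  have lh: "l k \<le> h k" for k using lv vh order_trans by blast
  have hdec: "h (Suc k) \<le> h k" for k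
  proof -
    have "0 \<le> t * (h k - l k)" using t0 lh[of k] by (intro mult_nonneg_nonneg) auto
    with hstep[of k] show ?thesis by linarith
  qed
  have gap: "h k - l k \<le> (1 - t) ^ k * (h 0 - l 0)" for k
  proof (induction k)
    case (Suc k)
    have "h (Suc k) - l (Suc k) \<le> (1 - t) * (h k - l k)"
      using hstep[of k] linc[of k] by (simp add: algebra_simps)
    also have "\<dots> \<le> (1 - t) * ((1 - t) ^ k * (h 0 - l 0))"
      using Suc t1 by (intro mult_left_mono) auto
    finally show ?case by simp
  qed simp
  have "(\<lambda>k. (1 - t) ^ k * (h 0 - l 0)) \<longlonglongrightarrow> 0 * (h 0 - l 0)"
    using t0 t1 by (intro tendsto_intros LIMSEQ_power_zero) auto
  then have "(\<lambda>k. h k - l k) \<longlonglongrightarrow> 0"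
    using tendsto_sandwich[of "\<lambda>_. 0" "\<lambda>k. h k - l k" sequentially "\<lambda>k. (1 - t) ^ k * (h 0 - l 0)" 0]
      gap lh by simp
  \<comment> \<open>The sign is flipped because \<open>nested_sequence_unique\<close> takes the
    lower sequence minus the upper one.\<close>
  then have "(\<lambda>k. l k - h k) \<longlonglongrightarrow> 0"
    using tendsto_minus[of "\<lambda>k. h k - l k" 0] by simp
  then obtain \<gamma> where \<gamma>: "\<And>k. l k \<le> \<gamma>" "l \<longlonglongrightarrow> \<gamma>" "h \<longlonglongrightarrow> \<gamma>"
    using nested_sequence_unique[of l h] linc hdec lh by auto
  show thesis
  proof
    show "0 < \<gamma>" using lpos[of 0] \<gamma>(1)[of 0] by simp
    show "(\<lambda>k. sinkhorn_weights S b k j) \<longlonglongrightarrow> \<gamma>" for j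
      using tendsto_sandwich[of l "\<lambda>k. v k j" sequentially h \<gamma>] lv vh \<gamma> by (simp add: v_def)
  qed
qed

lemma sinkhorn_row_pos:
  fixes S :: "real^'n^'n"
  assumes "\<And>i j. 0 < S $ i $ j" "\<And>j. 0 < v j"
  shows "0 < sinkhorn_row S v i"
  using assms by (auto simp: sinkhorn_row_def intro!: sum_pos divide_pos_pos mult_pos_pos)

lemma sinkhorn_col_pos:
  fixes S :: "real^'n^'n"
  assumes "\<And>i j. 0 < S $ i $ j" "\<And>i. 0 < u i"
  shows "0 < sinkhorn_col S u j"
  using assms by (auto simp: sinkhorn_col_def intro!: sum_pos divide_pos_pos mult_pos_pos)

lemma sinkhorn_weights_pos:
  fixes S :: "real^'n^'n"
  assumes "\<And>i j. 0 < S $ i $ j" "\<And>j. 0 < b j"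
  shows "0 < sinkhorn_weights S b k j"
  by (induction k arbitrary: j) (simp_all add: assms sinkhorn_row_pos sinkhorn_col_pos)

section \<open>From scaling vectors back to the matrix algorithm\<close>

text \<open>The state of the algorithm for A = diag a S diag b when the current matrix is diag u S diag v.\<close>

definition scaled_state :: "real^'n^'n \<Rightarrow> ('n \<Rightarrow> real) \<Rightarrow> ('n \<Rightarrow> real) \<Rightarrow> ('n \<Rightarrow> real) \<Rightarrow> ('n \<Rightarrow> real) \<Rightarrow>
    (real^'n^'n) \<times> (real^'n^'n) \<times> (real^'n^'n)" where
  "scaled_state S a b u v =
     (diag_matrix (\<lambda>i. u i / a i), \<chi> i j. u i * S $ i $ j * v j, diag_matrix (\<lambda>j. v j / b j))"

text \<open>Row \<open>i\<close> of \<open>B\<close> sums to \<open>u i\<close> times the sum that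
  defines \<open>sinkhorn_row S v i\<close>, so the rescaling factor is
  \<open>sinkhorn_row S v i / u i\<close>: it cancels the old \<open>u\<close> and puts in a vector
  that depends on \<open>v\<close> alone.\<close>

lemma row_step_scaled_state:
  fixes S :: "real^'n^'n"
  assumes "scaled_state S a b u v = (L, B, M)" and u: "\<And>i. 0 < u i"
  shows "(row_rescaling B ** L, row_rescaling B ** B, M) = scaled_state S a b (sinkhorn_row S v) v"
proof -
  have L: "L = diag_matrix (\<lambda>i. u i / a i)" and M: "M = diag_matrix (\<lambda>j. v j / b j)"
    and B: "\<And>i j. B $ i $ j = u i * (S $ i $ j * v j)"
    using assms(1) by (auto simp: scaled_state_def)
  then have R: "row_rescaling B = diag_matrix (\<lambda>i. sinkhorn_row S v i / u i)"
    by (simp add: row_rescaling_def diag_matrix_def vec_eq_iff sinkhorn_row_def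
        flip: sum_distrib_left)
  show ?thesis
    using less_imp_neq[OF u, symmetric]
    by (simp add: scaled_state_def R L M diag_matrix_mult)
      (simp add: vec_eq_iff B diag_matrix_mult_nth)
qed

lemma col_step_scaled_state:
  fixes S :: "real^'n^'n"
  assumes "scaled_state S a b u v = (L, B, M)" and v: "\<And>i. 0 < v i"
  shows "(L, B ** col_rescaling B, M ** col_rescaling B) = scaled_state S a b u (sinkhorn_col S u)"
proof -
  have L: "L = diag_matrix (\<lambda>i. u i / a i)" and M: "M = diag_matrix (\<lambda>j. v j / b j)"
    \<comment> \<open>The factor \<open>v j\<close> stands in front so that it can be pulled out of
      the column sum.\<close>
    and B: "\<And>i j. B $ i $ j = v j * (S $ i $ j * u i)"
    using assms(1) by (auto simp: scaled_state_def)
  then have R: "col_rescaling B = diag_matrix (\<lambda>j. sinkhorn_col S u j / v j)"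
    by (simp add: col_rescaling_def diag_matrix_def vec_eq_iff sinkhorn_col_def
        flip: sum_distrib_left)
  show ?thesis
    using less_imp_neq[OF v, symmetric]
    by (simp add: scaled_state_def R L M diag_matrix_mult)
      (simp add: vec_eq_iff B mult_diag_matrix_nth)
qed

text \<open>Odd steps replace the row vector and even steps the column vector, so two steps of
  \<open>sinkhorn\<close> make one step of \<open>sinkhorn_weights\<close>.\<close>

lemma sinkhorn_scaled_state:
  fixes S A :: "real^'n^'n"
  assumes S: "\<And>i j. 0 < S $ i $ j" and a: "\<And>i. 0 < a i" and b: "\<And>j. 0 < b j"
    and A: "\<And>i j. A $ i $ j = a i * S $ i $ j * b j"
  defines "v \<equiv> sinkhorn_weights S b"
  shows "sinkhorn A (Suc (2 * k)) = scaled_state S a b (sinkhorn_row S (v k)) (v k)"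
    and "sinkhorn A (Suc (Suc (2 * k))) = scaled_state S a b (sinkhorn_row S (v k)) (v (Suc k))"
proof -
  have vpos: "0 < v k j" for k j unfolding v_def using S b by (rule sinkhorn_weights_pos)
  have row: "sinkhorn A (Suc (2 * k)) = scaled_state S a b (sinkhorn_row S (v k)) (v k)"
    if "sinkhorn A (2 * k) = scaled_state S a b u (v k)" "\<And>i. 0 < u i" for k u
  proof -
    obtain L B M where "scaled_state S a b u (v k) = (L, B, M)" by (cases "scaled_state S a b u (v k)")
    with row_step_scaled_state[OF this that(2)] that(1) show ?thesis by simp
  qed
  have col: "sinkhorn A (Suc (Suc (2 * k))) = scaled_state S a b (sinkhorn_row S (v k)) (v (Suc k))"
    if "sinkhorn A (Suc (2 * k)) = scaled_state S a b (sinkhorn_row S (v k)) (v k)" for k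
  proof -
    let ?s = "scaled_state S a b (sinkhorn_row S (v k)) (v k)"
    obtain L B M where "?s = (L, B, M)" by (cases ?s)
    with col_step_scaled_state[OF this vpos] that show ?thesis by (simp add: v_def)
  qed
  \<comment> \<open>Starting from the vectors \<open>a\<close> and \<open>b\<close>, the current
    matrix is \<open>A\<close> and both accumulated rescalings are the identity.\<close>
  have "sinkhorn A 0 = scaled_state S a b a (v 0)"
    using less_imp_neq[OF a, symmetric] less_imp_neq[OF b, symmetric]
    by (simp add: scaled_state_def v_def diag_matrix_one vec_eq_iff A)
  \<comment> \<open>The row vector is \<open>a\<close> at step 0 and an earlier
    \<open>sinkhorn_row\<close> afterwards. Mere existence of a positive one suffices, because the
    next row step discards it.\<close>
  then have even: "\<exists>u. (\<forall>i. 0 < u i) \<and> sinkhorn A (2 * k) = scaled_state S a b u (v k)" for k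
  proof (induction k)
    case 0
    then show ?case using a by auto
  next
    case (Suc k)
    then show ?case using col[OF row] sinkhorn_row_pos[OF S vpos]
      by (intro exI[of _ "sinkhorn_row S (v k)"]) auto
  qed
  then show "sinkhorn A (Suc (2 * k)) = scaled_state S a b (sinkhorn_row S (v k)) (v k)"
    using row by blast
  then show "sinkhorn A (Suc (Suc (2 * k))) = scaled_state S a b (sinkhorn_row S (v k)) (v (Suc k))"
    by (rule col)
qed

lemma tendsto_scaled_state:
  fixes S :: "real^'n^'n"
  assumes "\<And>i. ((\<lambda>k. u k i) \<longlongrightarrow> u' i) F" "\<And>j. ((\<lambda>k. v k j) \<longlongrightarrow> v' j) F"
    and "\<And>i. a i \<noteq> 0" "\<And>j. b j \<noteq> 0"
  shows "((\<lambda>k. scaled_state S a b (u k) (v k)) \<longlongrightarrow> scaled_state S a b u' v') F"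
  unfolding scaled_state_def
  by (intro tendsto_Pair vec_tendstoI)
    (auto simp: diag_matrix_nth intro!: tendsto_intros assms)

text \<open>When the column weights tend to \<gamma>, the row weights tend to its inverse, as the
  rows of \<open>S\<close> sum to 1. The two constants cancel in the current matrix, whose limit is
  \<open>S\<close>, but remain in the accumulated rescalings.\<close>

lemma sinkhorn_tendsto:
  fixes S A :: "real^'n^'n"
  assumes ds: "doubly_stochastic S" and S: "\<And>i j. 0 < S $ i $ j"
    and a: "\<And>i. 0 < a i" and b: "\<And>j. 0 < b j"
    and A: "\<And>i j. A $ i $ j = a i * S $ i $ j * b j"
  obtains \<gamma> where "0 < \<gamma>"
    "sinkhorn A \<longlonglongrightarrow> (diag_matrix (\<lambda>i. inverse (\<gamma> * a i)), S, diag_matrix (\<lambda>j. \<gamma> / b j))"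
proof -
  obtain \<gamma> where \<gamma>: "0 < \<gamma>" and lim: "\<And>j. (\<lambda>k. sinkhorn_weights S b k j) \<longlonglongrightarrow> \<gamma>"
    using sinkhorn_weights_tendsto_const[of S b] ds S b by blast
  let ?v = "sinkhorn_weights S b"
  let ?s = "scaled_state S a b (\<lambda>_. inverse \<gamma>) (\<lambda>_. \<gamma>)"
  have rows: "(\<Sum>j\<in>UNIV. S $ i $ j) = 1" for i
    using ds by (simp add: doubly_stochastic_def)
  have u: "(\<lambda>k. sinkhorn_row S (?v k) i) \<longlonglongrightarrow> inverse \<gamma>" for i
  proof -
    have "(\<lambda>k. \<Sum>j\<in>UNIV. S $ i $ j * ?v k j) \<longlonglongrightarrow> (\<Sum>j\<in>UNIV. S $ i $ j * \<gamma>)"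
      by (intro tendsto_intros lim)
    then have "(\<lambda>k. \<Sum>j\<in>UNIV. S $ i $ j * ?v k j) \<longlonglongrightarrow> \<gamma>"
      by (simp add: rows flip: sum_distrib_right)
    then have "(\<lambda>k. inverse (\<Sum>j\<in>UNIV. S $ i $ j * ?v k j)) \<longlonglongrightarrow> inverse \<gamma>"
      using \<gamma> by (intro tendsto_inverse) auto
    then show ?thesis by (simp add: sinkhorn_row_def inverse_eq_divide)
  qed
  have ne: "a i \<noteq> 0" "b j \<noteq> 0" for i j using a[of i] b[of j] by auto
  have odd: "(\<lambda>k. sinkhorn A (Suc (2 * k))) \<longlonglongrightarrow> ?s"
    unfolding sinkhorn_scaled_state(1)[OF S a b A] by (rule tendsto_scaled_state[OF u lim ne])
  \<comment> \<open>The closed form covers the even steps from 2 on; \<open>LIMSEQ_imp_Suc\<close>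
    then restores step 0.\<close>
  have "(\<lambda>k. sinkhorn A (2 * Suc k)) \<longlonglongrightarrow> ?s"
    using tendsto_scaled_state[OF u LIMSEQ_Suc[OF lim] ne]
    by (simp add: sinkhorn_scaled_state(2)[OF S a b A] del: sinkhorn.simps sinkhorn_weights.simps)
  then have even: "(\<lambda>k. sinkhorn A (2 * k)) \<longlonglongrightarrow> ?s"
    by (rule LIMSEQ_imp_Suc)
  have "?s = (diag_matrix (\<lambda>i. inverse (\<gamma> * a i)), S, diag_matrix (\<lambda>j. \<gamma> / b j))"
    using \<gamma> by (auto simp: scaled_state_def vec_eq_iff diag_matrix_def field_simps)
  with limseq_even_odd[OF even] odd \<gamma> show thesis by (intro that) auto
qed

section \<open>Recovery of the factors from the limit\<close>

theorem theorem3: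
  fixes X \<Lambda> Q M :: "real^'n^'n"
  assumes "\<And>i j. X $ i $ j \<noteq> 0"
    and "diagonal_matrix \<Lambda>" and "diagonal_matrix M" and "orthogonal_matrix Q"
    and "X = \<Lambda> ** Q ** M"
  shows "(\<exists>\<Lambda>\<^sub>s Q\<^sub>s M\<^sub>s. sinkhorn (entrywise_square X) \<longlonglongrightarrow> (\<Lambda>\<^sub>s, Q\<^sub>s, M\<^sub>s) \<and>
            positive_diagonal \<Lambda>\<^sub>s \<and> doubly_stochastic Q\<^sub>s \<and> positive_diagonal M\<^sub>s \<and>
            \<Lambda>\<^sub>s ** entrywise_square X ** M\<^sub>s = Q\<^sub>s) \<and>
         (\<exists>\<Lambda>' Q' M'. sinkhorn_algorithm X = (\<Lambda>', Q', M') \<and>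
            diagonal_matrix \<Lambda>' \<and> orthogonal_matrix Q' \<and> diagonal_matrix M' \<and>
            X = \<Lambda>' ** Q' ** M' \<and>
            (\<exists>P\<^sub>1 P\<^sub>2 D\<^sub>1 D\<^sub>2 c. permutation_matrix P\<^sub>1 \<and> permutation_matrix P\<^sub>2 \<and>
               sign_diagonal D\<^sub>1 \<and> sign_diagonal D\<^sub>2 \<and> c > 0 \<and>
               \<Lambda>' = c *\<^sub>R (P\<^sub>1 ** \<Lambda> ** D\<^sub>1 ** transpose P\<^sub>1) \<and>
               Q' = P\<^sub>1 ** D\<^sub>1 ** Q ** D\<^sub>2 ** transpose P\<^sub>2 \<and>
               M' = inverse c *\<^sub>R (P\<^sub>2 ** D\<^sub>2 ** M ** transpose P\<^sub>2)))"
proof -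
  define f where "f i = \<Lambda> $ i $ i" for i
  define g where "g i = M $ i $ i" for i
  have \<Lambda>: "\<Lambda> = diag_matrix f" and M: "M = diag_matrix g"
    unfolding f_def g_def by (rule diagonal_matrix_eq_diag_matrix, fact assms)+
  have X: "X $ i $ j = f i * Q $ i $ j * g j" for i j
    by (simp add: assms(5) \<Lambda> M diag_matrix_mult_nth mult_diag_matrix_nth)
  \<comment> \<open>A zero among these factors would give a zero entry of \<open>X\<close>.\<close>
  have nz: "f i \<noteq> 0" "Q $ i $ j \<noteq> 0" "g j \<noteq> 0" for i j
    using assms(1)[of i j] X[of i j] by auto
  let ?S = "entrywise_square Q"
  have ds: "doubly_stochastic ?S"
    using assms(4) by (rule doubly_stochastic_square_orthogonal)
  have A: "entrywise_square X $ i $ j = (f i)\<^sup>2 * ?S $ i $ j * (g j)\<^sup>2" for i j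
    by (simp add: entrywise_square_def X power_mult_distrib)
  obtain \<gamma> where \<gamma>: "0 < \<gamma>" and lim: "sinkhorn (entrywise_square X) \<longlonglongrightarrow>
      (diag_matrix (\<lambda>i. inverse (\<gamma> * (f i)\<^sup>2)), ?S, diag_matrix (\<lambda>j. \<gamma> / (g j)\<^sup>2))"
    (is "_ \<longlonglongrightarrow> (?\<Lambda>s, _, ?Ms)")
  proof (rule sinkhorn_tendsto[OF ds _ _ _ A])
    show "0 < ?S $ i $ j" for i j using nz by (simp add: entrywise_square_def)
  qed (use nz in simp_all)
  \<comment> \<open>The limiting row rescaling has entries
    \<open>inverse (\<gamma> * (f i)\<^sup>2)\<close>; its inverted root is
    \<open>sqrt \<gamma> * \<bar>f i\<bar>\<close>, which fixes the scale \<open>?c\<close>. The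
    signs lost to the absolute values go into \<open>?D1\<close> and \<open>?D2\<close>.\<close>
  let ?c = "sqrt \<gamma>"
  let ?D1 = "diag_matrix (\<lambda>i. sgn (f i))" and ?D2 = "diag_matrix (\<lambda>j. sgn (g j))"
  let ?L' = "diag_matrix (\<lambda>i. ?c * \<bar>f i\<bar>)" and ?M' = "diag_matrix (\<lambda>j. \<bar>g j\<bar> / ?c)"
  let ?Q' = "?D1 ** Q ** ?D2"
  have sqrt_diag: "entrywise_sqrt (diag_matrix h) = diag_matrix (\<lambda>i. sqrt (h i))" for h :: "'n \<Rightarrow> real"
    by (simp add: entrywise_sqrt_def diag_matrix_def vec_eq_iff)
  \<comment> \<open>The sign of an entry of \<open>X\<close> is the product of three signs. The
    middle one turns the absolute value of the entry of \<open>Q\<close> back into that entry, and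
    the outer two are \<open>?D1\<close> and \<open>?D2\<close>.\<close>
  have Q': "sign_matrix X \<odot> entrywise_sqrt ?S = ?Q'"
    by (simp add: hadamard_def sign_matrix_def entrywise_sqrt_def entrywise_square_def vec_eq_iff X
        diag_matrix_mult_nth mult_diag_matrix_nth sgn_mult mult_ac sgn_mult_abs)
      (metis sgn_mult_abs mult.commute)
  \<comment> \<open>The proved convergence determines the value of \<open>lim\<close> in the
    algorithm.\<close>
  have alg: "sinkhorn_algorithm X = (?L', ?Q', ?M')"
    using \<gamma> nz
    by (simp add: sinkhorn_algorithm_def limI[OF lim] Q' sqrt_diag matrix_inv_diag_matrix
        real_sqrt_mult real_sqrt_divide real_sqrt_inverse)
  have sgn2: "sgn (f i) * sgn (f i) = 1" "sgn (g i) * sgn (g i) = 1" for i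
    using nz by (auto simp: sgn_if)
  show ?thesis
  proof (intro conjI exI)
    show "sinkhorn (entrywise_square X) \<longlonglongrightarrow> (?\<Lambda>s, ?S, ?Ms)" by (fact lim)
    show "positive_diagonal ?\<Lambda>s" "positive_diagonal ?Ms"
      using \<gamma> nz by (simp_all add: positive_diagonal_def diag_matrix_nth)
    show "doubly_stochastic ?S" by (fact ds)
    show "?\<Lambda>s ** entrywise_square X ** ?Ms = ?S"
      using \<gamma> nz by (simp add: vec_eq_iff diag_matrix_mult_nth mult_diag_matrix_nth A field_simps)
    show "sinkhorn_algorithm X = (?L', ?Q', ?M')" by (fact alg)
    show "diagonal_matrix ?L'" "diagonal_matrix ?M'" by simp_all
    show "orthogonal_matrix ?Q'"
      by (intro orthogonal_matrix_mul orthogonal_diag_matrix sgn2 assms(4))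
    have "?c * \<bar>f i\<bar> * (sgn (f i) * Q $ i $ j * sgn (g j)) * (\<bar>g j\<bar> / ?c)
        = (\<bar>f i\<bar> * sgn (f i)) * Q $ i $ j * (\<bar>g j\<bar> * sgn (g j))" for i j
      using \<gamma> by (simp add: field_simps)
    then show "X = ?L' ** ?Q' ** ?M'"
      by (simp only: vec_eq_iff diag_matrix_mult_nth mult_diag_matrix_nth X abs_mult_sgn) simp
    \<comment> \<open>The algorithm never reorders rows or columns, so both permutations are the
      identity.\<close>
    show "permutation_matrix (mat 1 :: real^'n^'n)" "permutation_matrix (mat 1 :: real^'n^'n)"
      unfolding permutation_matrix_def mat_def by (intro exI[of _ id]; auto simp: vec_eq_iff)+
    show "sign_diagonal ?D1" "sign_diagonal ?D2"
      using nz by (auto simp: sign_diagonal_def diag_matrix_nth sgn_if)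
    show "0 < ?c" using \<gamma> by simp
    show "?L' = ?c *\<^sub>R (mat 1 ** \<Lambda> ** ?D1 ** transpose (mat 1))"
      by (simp add: \<Lambda> diag_matrix_mult vec_eq_iff diag_matrix_nth abs_sgn)
    show "?Q' = mat 1 ** ?D1 ** Q ** ?D2 ** transpose (mat 1)" by simp
    show "?M' = inverse ?c *\<^sub>R (mat 1 ** ?D2 ** M ** transpose (mat 1))"
      by (simp add: M diag_matrix_mult vec_eq_iff diag_matrix_nth abs_sgn field_simps)
  qed
qed

end
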